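(* Let $\alpha$ be a set with an involution $\tau:\alpha\to\alpha$, and let $\mathcal N_c=\mathcal N_c(\alpha,\tau)$ be the group of cobordism classes of nanowords over $\alpha$. If $\tau$ has at least two orbits, then $\mathcal N_c$ is infinite. If $\tau$ has at least two orbits and $\tau\ne\mathrm{id}$, then $\mathcal N_c$ is infinitely generated (i.e. not finitely generated). If $\tau$ has at least three orbits, or $\tau$ has two orbits and $\tau\neq\mathrm{id}$, then $\mathcal N_c$ is non-abelian.
   Context: **Nanowords.** $\alpha$ is a set with an involution $\tau:\alpha\to\alpha$ ($\tau^2=\mathrm{id}$; fixed points allowed). An $\alpha$-alphabet is a set $\mathcal A$ with a map $\mathcal A\to\alpha$, $A\mapsto|A|$. A nanoword of length $n$ over $\alpha$ is a pair $(\mathcal A,w)$ with $\mathcal A$ an $\alpha$-alphabet and $w:\{1,\dots,n\}\to\mathcal A$ a map (written as the sequence $w(1)\cdots w(n)$) taking every value in $\mathcal A$ exactly twice; there is a unique empty nanoword $\emptyset$. Nanowords $(\mathcal A,w),(\mathcal A',w')$ are isomorphic if $w'=fw$ for a bijection $f:\mathcal A\to\mathcal A'$ with $|f(A)|=|A|$. The opposite word of $w$ is $w^-=w(n)\cdots w(1)$. The product of two nanowords is their concatenation, after making the alphabets disjoint by an isomorphism. **Homotopy moves.** (1) $(\mathcal A,xAAy)\mapsto(\mathcal A-\{A\},xy)$; (2) $(\mathcal A,xAByBAz)\mapsto(\mathcal A-\{A,B\},xyz)$ if $|B|=\tau(|A|)$; (3) $(\mathcal A,xAByACzBCt)\mapsto(\mathcal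 A,xBAyCAzCBt)$ for distinct $A,B,C$ with $|A|=|B|=|C|$. **Surgery.** A nanophrase $\nabla=(\mathcal B,(v_1|\cdots|v_k))$ is a sequence of words in an $\alpha$-alphabet $\mathcal B$ such that every letter of $\mathcal B$ appears exactly twice in $v_1v_2\cdots v_k$. Put $\varepsilon_\nabla(B)=0$ if both occurrences of $B$ are in the same $v_r$, and $\varepsilon_\nabla(B)=1$ otherwise. $\nabla$ is even if all $v_r$ have even length; it is symmetric if there is a bijection $\iota:\mathcal B\to\mathcal B$ with $\iota v_r=v_r^-$ for all $r$ and $|\iota(B)|=\tau^{\varepsilon_\nabla(B)}(|B|)$ for all $B$. $\nabla$ is a factor of a nanoword $(\mathcal A,w)$ if $\mathcal B\subset\mathcal A$ (with restricted projection to $\alpha$) and $w=x_1v_1x_2v_2\cdots x_kv_kx_{k+1}$ with $x_i$ words in $\mathcal A-\mathcal B$. A surgery replaces $(\mathcal A,w)$ by $(\mathcal A-\mathcal B,x_1x_2\cdots x_{k+1})$, where $\nabla$ is an even symmetric factor. **Cobordism.** Two nanowords are cobordant if they are related by a finite sequence of isomorphisms, homotopy moves, surgeries and inverse moves. The cobordism classes form a group $\mathcal N_c=\mathcal N_c(\alpha,\tau)$ under concatenation, with unit the class of $\emptyset$ and inverse of $w$ given by $w^-$. *)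

theory Defs
  imports "HOL-Algebra.Generated_Groups" "HOL-Combinatorics.Orbits"
begin

text \<open>
  A pair (p, w) consists of the word w and the projection p of letters to \<open>\<alpha>\<close>.
  The alphabet is not stored: every letter of the alphabet of a nanoword occurs in the word, so
  the alphabet is \<open>set w\<close>, and only the values of p on \<open>set w\<close> matter. Two pairs that differ
  only in the other values of p are isomorphic.
\<close>

type_synonym ('l, 'a) nanoword = "('l \<Rightarrow> 'a) \<times> 'l list"

definition nanowords :: "'a set \<Rightarrow> ('l, 'a) nanoword set" where
  "nanowords \<alpha> = {(p, w). \<forall>A\<in>set w. count_list w A = 2 \<and> p A \<in> \<alpha>}"

definition nw_iso :: "('l, 'a) nanoword \<Rightarrow> ('m, 'a) nanoword \<Rightarrow> bool" where
  "nw_iso u u' \<longleftrightarrow>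
     (\<exists>f. bij_betw f (set (snd u)) (set (snd u')) \<and> snd u' = map f (snd u) \<and>
          (\<forall>A\<in>set (snd u). fst u' (f A) = fst u A))"

inductive homotopy_move :: "('a \<Rightarrow> 'a) \<Rightarrow> ('l, 'a) nanoword \<Rightarrow> ('l, 'a) nanoword \<Rightarrow> bool"
  for \<tau> :: "'a \<Rightarrow> 'a" where
  move1: "homotopy_move \<tau> (p, x @ [A, A] @ y) (p, x @ y)"
| move2: "p B = \<tau> (p A) \<Longrightarrow>
    homotopy_move \<tau> (p, x @ [A, B] @ y @ [B, A] @ z) (p, x @ y @ z)"
| move3: "distinct [A, B, C] \<Longrightarrow> p A = p B \<Longrightarrow> p B = p C \<Longrightarrow>
    homotopy_move \<tau> (p, x @ [A, B] @ y @ [A, C] @ z @ [B, C] @ t)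
                    (p, x @ [B, A] @ y @ [C, A] @ z @ [C, B] @ t)"

definition phrase_eps :: "'l list list \<Rightarrow> 'l \<Rightarrow> nat" where
  "phrase_eps vs B = (if \<exists>v\<in>set vs. count_list v B = 2 then 0 else 1)"

definition nanophrase :: "'a set \<Rightarrow> ('l \<Rightarrow> 'a) \<Rightarrow> 'l list list \<Rightarrow> bool" where
  "nanophrase \<alpha> p vs \<longleftrightarrow> (p, concat vs) \<in> nanowords \<alpha>"

definition even_phrase :: "'l list list \<Rightarrow> bool" where
  "even_phrase vs \<longleftrightarrow> (\<forall>v\<in>set vs. even (length v))"

definition symmetric_phrase :: "('a \<Rightarrow> 'a) \<Rightarrow> ('l \<Rightarrow> 'a) \<Rightarrow> 'l list list \<Rightarrow> bool" where
  "symmetric_phrase \<tau> p vs \<longleftrightarrow>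
     (\<exists>\<iota>. bij_betw \<iota> (set (concat vs)) (set (concat vs)) \<and>
          (\<forall>v\<in>set vs. map \<iota> v = rev v) \<and>
          (\<forall>B\<in>set (concat vs). p (\<iota> B) = (\<tau> ^^ phrase_eps vs B) (p B)))"

text \<open>
  The words surrounding the factor are the entries of xs, each placed in front of the
  corresponding entry of vs, and the final word z.
\<close>

inductive surgery ::
  "'a set \<Rightarrow> ('a \<Rightarrow> 'a) \<Rightarrow> ('l, 'a) nanoword \<Rightarrow> ('l, 'a) nanoword \<Rightarrow> bool"
  for \<alpha> :: "'a set" and \<tau> :: "'a \<Rightarrow> 'a" where
  "nanophrase \<alpha> p vs \<Longrightarrow> even_phrase vs \<Longrightarrow> symmetric_phrase \<tau> p vs \<Longrightarrow>
   length xs = length vs \<Longrightarrow>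
   set (concat xs @ z) \<inter> set (concat vs) = {} \<Longrightarrow>
   surgery \<alpha> \<tau> (p, concat (map2 (@) xs vs) @ z) (p, concat xs @ z)"

definition cob_step ::
  "'a set \<Rightarrow> ('a \<Rightarrow> 'a) \<Rightarrow> ('l, 'a) nanoword \<Rightarrow> ('l, 'a) nanoword \<Rightarrow> bool" where
  "cob_step \<alpha> \<tau> u u' \<longleftrightarrow> u \<in> nanowords \<alpha> \<and> u' \<in> nanowords \<alpha> \<and>
     (nw_iso u u' \<or> homotopy_move \<tau> u u' \<or> surgery \<alpha> \<tau> u u')"

definition cobordism :: "'a set \<Rightarrow> ('a \<Rightarrow> 'a) \<Rightarrow> (('l, 'a) nanoword \<times> ('l, 'a) nanoword) set" where
  "cobordism \<alpha> \<tau> =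
     {(u, u'). u \<in> nanowords \<alpha> \<and> u' \<in> nanowords \<alpha> \<and> equivclp (cob_step \<alpha> \<tau>) u u'}"

text \<open>
  Letters are now natural numbers. This is no restriction: a nanoword has finitely many letters,
  hence is isomorphic to one with letters in nat, and fresh letters are always available for the
  inverse moves. In the product the first alphabet is moved to the even numbers and the second
  one to the odd numbers.
\<close>

definition nw_mult :: "(nat, 'a) nanoword \<Rightarrow> (nat, 'a) nanoword \<Rightarrow> (nat, 'a) nanoword" where
  "nw_mult u v =
     (\<lambda>n. if even n then fst u (n div 2) else fst v (n div 2),
      map (\<lambda>n. 2 * n) (snd u) @ map (\<lambda>n. 2 * n + 1) (snd v))"

definition nw_empty :: "(nat, 'a) nanoword" where
  "nw_empty = (\<lambda>_. undefined, [])"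

definition nw_opposite :: "('l, 'a) nanoword \<Rightarrow> ('l, 'a) nanoword" where
  "nw_opposite u = (fst u, rev (snd u))"

definition cobordism_group :: "'a set \<Rightarrow> ('a \<Rightarrow> 'a) \<Rightarrow> (nat, 'a) nanoword set monoid" where
  "cobordism_group \<alpha> \<tau> =
     \<lparr>carrier = nanowords \<alpha> // cobordism \<alpha> \<tau>,
      monoid.mult = (\<lambda>X Y. \<Union>u\<in>X. \<Union>v\<in>Y. cobordism \<alpha> \<tau> `` {nw_mult u v}),
      one = cobordism \<alpha> \<tau> `` {nw_empty}\<rparr>"

definition orbits_of :: "'a set \<Rightarrow> ('a \<Rightarrow> 'a) \<Rightarrow> 'a set set" where
  "orbits_of \<alpha> \<tau> = orbit \<tau> ` \<alpha>"

definition at_least_elems :: "nat \<Rightarrow> 'b set \<Rightarrow> bool" where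
  "at_least_elems n X \<longleftrightarrow> infinite X \<or> n \<le> card X"

definition finitely_generated_group :: "('g, 'b) monoid_scheme \<Rightarrow> bool" where
  "finitely_generated_group G \<longleftrightarrow> (\<exists>S. finite S \<and> S \<subseteq> carrier G \<and> generate G S = carrier G)"


section \<open>The cobordism classes form a group\<close>

lemma equiv_cobordism: "equiv (nanowords \<alpha>) (cobordism \<alpha> \<tau>)"
proof (rule equivI)
  show "sym (cobordism \<alpha> \<tau>)"
    unfolding cobordism_def by (rule symI) (auto dest: equivclp_sym)
  show "trans (cobordism \<alpha> \<tau>)"
    unfolding cobordism_def by (rule transI) (auto dest: equivclp_trans)
qed (auto simp: cobordism_def refl_on_def)

lemma cob_stepI: "cob_step \<alpha> \<tau> u v \<Longrightarrow> (u, v) \<in> cobordism \<alpha> \<tau>"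
  by (auto simp: cobordism_def cob_step_def intro: r_into_equivclp)

lemma count_list_zero: "a \<notin> set w \<Longrightarrow> count_list w a = 0"
  by (simp add: count_list_0_iff)

lemma count_list_map_inj: "inj f \<Longrightarrow> count_list (map f w) (f a) = count_list w a"
  by (induction w) (auto dest: injD)

lemma nw_mult_closed:
  assumes "u \<in> nanowords \<alpha>" "v \<in> nanowords \<alpha>"
  shows "nw_mult u v \<in> nanowords \<alpha>"
proof -
  have i1: "inj (\<lambda>n::nat. 2 * n)" by (auto simp: inj_def)
  have i2: "inj (\<lambda>n::nat. Suc (2 * n))" by (auto simp: inj_def)
  have d1: "count_list (map (\<lambda>n. Suc (2 * n)) w) (2 * a) = 0" for w and a :: nat
    by (rule count_list_zero) (auto, presburger)
  have d2: "count_list (map (\<lambda>n. 2 * n) w) (Suc (2 * a)) = 0" for w and a :: nat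
    by (rule count_list_zero) (auto, presburger)
  show ?thesis
    using assms
    by (auto simp: nanowords_def nw_mult_def d1 d2 count_list_map_inj[OF i1] count_list_map_inj[OF i2])
qed

lemma nw_isoI:
  assumes "inj_on f (set (snd u))" "snd u' = map f (snd u)"
    and "\<And>A. A \<in> set (snd u) \<Longrightarrow> fst u' (f A) = fst u A"
  shows "nw_iso u u'"
  unfolding nw_iso_def using assms by (intro exI[of _ f]) (auto simp: bij_betw_def)

lemma homotopy_move_context:
  assumes "homotopy_move \<tau> (p, w) (q, w')" "inj f" "\<And>a. P (f a) = p a"
  shows "homotopy_move \<tau> (P, L @ map f w @ R) (P, L @ map f w' @ R)"
  using assms(1)
proof cases
  case (move1 x A y)
  then show ?thesis
    using homotopy_move.move1[of \<tau> P "L @ map f x" "f A" "map f y @ R"] by simp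
next
  case (move2 B A x y z)
  then show ?thesis
    using homotopy_move.move2[of P "f B" \<tau> "f A" "L @ map f x" "map f y" "map f z @ R"] assms(3)
    by simp
next
  case (move3 A B C x y z t)
  then show ?thesis
    using homotopy_move.move3[of "f A" "f B" "f C" P \<tau> "L @ map f x" "map f y" "map f z" "map f t @ R"]
      assms(2,3)
    by (simp add: inj_eq)
qed

lemma surgery_map:
  assumes "surgery \<alpha> \<tau> (p, w) (q, w')" "inj f" "\<And>a. P (f a) = p a" "set R \<inter> range f = {}"
  shows "surgery \<alpha> \<tau> (P, map f w @ R) (P, map f w' @ R)"
  using assms(1)
proof cases
  case (1 vs xs z)
  let ?vs = "map (map f) vs" and ?xs = "map (map f) xs"
  have c: "concat ?vs = map f (concat vs)" by (simp add: map_concat)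
  have n: "nanophrase \<alpha> P ?vs"
    using 1 assms(2,3)
    by (auto simp: nanophrase_def c nanowords_def count_list_map_inj simp del: set_concat)
  have e: "even_phrase ?vs" using 1 by (auto simp: even_phrase_def)
  have eps: "phrase_eps ?vs (f b) = phrase_eps vs b" for b
    using assms(2) by (auto simp: phrase_eps_def count_list_map_inj)
  obtain \<iota> where i: "bij_betw \<iota> (set (concat vs)) (set (concat vs))"
    "\<And>v. v \<in> set vs \<Longrightarrow> map \<iota> v = rev v"
    "\<And>B. B \<in> set (concat vs) \<Longrightarrow> p (\<iota> B) = (\<tau> ^^ phrase_eps vs B) (p B)"
    using 1 unfolding symmetric_phrase_def by blast
  let ?i = "f \<circ> \<iota> \<circ> inv_into UNIV f"
  have inv: "inv_into UNIV f (f a) = a" for a using assms(2) by simp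
  have "bij_betw (inv_into UNIV f) (f ` set (concat vs)) (set (concat vs))"
    using assms(2) by (auto simp: bij_betw_def inj_on_def image_image inv)
  moreover have "bij_betw f (set (concat vs)) (f ` set (concat vs))"
    using assms(2) by (auto simp: bij_betw_def inj_on_def)
  ultimately have "bij_betw ?i (f ` set (concat vs)) (f ` set (concat vs))"
    using i(1) by (blast intro: bij_betw_trans)
  moreover have "map ?i v' = rev v'" if v': "v' \<in> set ?vs" for v'
  proof -
    obtain v where v: "v \<in> set vs" "v' = map f v" using v' by auto
    have "map ?i v' = map f (map \<iota> v)" using v(2) assms(2) by simp
    also have "\<dots> = rev v'" unfolding i(2)[OF v(1)] v(2) by (simp add: rev_map)
    finally show ?thesis .
  qed
  ultimately have s: "symmetric_phrase \<tau> P ?vs"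
    unfolding symmetric_phrase_def
    by (intro exI[of _ ?i])
      (use i(3) in \<open>auto simp: c eps inv assms(3) simp del: set_concat map_eq_conv\<close>)
  have m: "concat (map2 (@) ?xs ?vs) = map f (concat (map2 (@) xs vs))"
    using 1(7) by (induction xs vs rule: list_induct2) auto
  have d: "set (concat ?xs @ (map f z @ R)) \<inter> set (concat ?vs) = {}"
  proof -
    have "f ` set (concat xs @ z) \<inter> f ` set (concat vs) = {}"
      using 1(8) assms(2) by (metis image_Int image_empty)
    moreover have "set R \<inter> f ` set (concat vs) = {}" using assms(4) by blast
    ultimately show ?thesis by (auto simp: c simp del: set_concat) (auto simp: map_concat)
  qed
  show ?thesis
    using surgery.intros[OF n e s _ d] 1 m by (simp add: map_concat)
qed

lemma surgery_prefix:
  assumes "surgery \<alpha> \<tau> (p, w) (q, w')" "set L \<inter> set w = {}"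
  shows "surgery \<alpha> \<tau> (p, L @ w) (p, L @ w')"
  using assms(1)
proof cases
  case (1 vs xs z)
  show ?thesis
  proof (cases vs)
    case Nil
    then show ?thesis using 1 surgery.intros[of \<alpha> p "[]" \<tau> "[]" "L @ z"] by simp
  next
    case (Cons v vs')
    then obtain x xs' where x: "xs = x # xs'" using 1 by (cases xs) auto
    have "set (concat vs) \<subseteq> set w"
    proof -
      have "set (concat vs) \<subseteq> set (concat (map2 (@) xs vs))"
        using 1(7) by (induction xs vs rule: list_induct2) auto
      then show ?thesis using 1 by auto
    qed
    then have d: "set (concat ((L @ x) # xs') @ z) \<inter> set (concat vs) = {}"
      using assms(2) 1(8) x by auto
    have "length ((L @ x) # xs') = length vs" using 1 x by simp
    from surgery.intros[OF 1(4,5,6) this d] show ?thesis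
      using 1 x Cons by simp
  qed
qed

lemma homotopy_move_fst: "homotopy_move \<tau> u v \<Longrightarrow> fst v = fst u"
  by (cases rule: homotopy_move.cases) auto

lemma surgery_fst: "surgery \<alpha> \<tau> u v \<Longrightarrow> fst v = fst u"
  by (cases rule: surgery.cases) auto

lemma cob_step_mult_left:
  assumes st: "cob_step \<alpha> \<tau> u u'" and v: "v \<in> nanowords \<alpha>"
  shows "cob_step \<alpha> \<tau> (nw_mult u v) (nw_mult u' v)"
proof -
  obtain p w q w' where uu: "u = (p, w)" "u' = (q, w')" by fastforce
  have N: "nw_mult u v \<in> nanowords \<alpha>" "nw_mult u' v \<in> nanowords \<alpha>"
    using st v by (auto simp: cob_step_def intro: nw_mult_closed)
  define f where "f = (\<lambda>n::nat. 2 * n)"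
  define R where "R = map (\<lambda>n. 2 * n + 1) (snd v)"
  define P where "P = (\<lambda>n. if even n then p (n div 2) else fst v (n div 2))"
  have f: "inj f" by (auto simp: f_def inj_def)
  have P: "P (f a) = p a" for a by (simp add: P_def f_def)
  have R: "set R \<inter> range f = {}" unfolding R_def f_def by (auto, presburger)
  have m: "nw_mult u v = (P, map f w @ R)" by (simp add: fun_eq_iff nw_mult_def uu P_def R_def f_def)
  have m': "nw_mult u' v = (P, map f w' @ R)" if "p = q"
    using that by (simp add: fun_eq_iff nw_mult_def uu P_def R_def f_def)
  consider "nw_iso u u'" | "homotopy_move \<tau> u u'" | "surgery \<alpha> \<tau> u u'"
    using st by (auto simp: cob_step_def)
  then have "nw_iso (nw_mult u v) (nw_mult u' v) \<or> homotopy_move \<tau> (nw_mult u v) (nw_mult u' v)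
    \<or> surgery \<alpha> \<tau> (nw_mult u v) (nw_mult u' v)"
  proof cases
    case 1
    then obtain g where g: "bij_betw g (set w) (set w')" "w' = map g w" "\<forall>A\<in>set w. q (g A) = p A"
      by (auto simp: nw_iso_def uu)
    have "nw_iso (nw_mult u v) (nw_mult u' v)"
    proof (rule nw_isoI[of "\<lambda>n. if even n then 2 * g (n div 2) else n"])
      show "inj_on (\<lambda>n. if even n then 2 * g (n div 2) else n) (set (snd (nw_mult u v)))"
      proof (rule inj_onI)
        fix x y
        assume xy: "x \<in> set (snd (nw_mult u v))" "y \<in> set (snd (nw_mult u v))"
          and eq: "(if even x then 2 * g (x div 2) else x) = (if even y then 2 * g (y div 2) else y)"
        have in_w: "n div 2 \<in> set w" if "n \<in> set (snd (nw_mult u v))" "even n" for n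
          using that by (auto simp: nw_mult_def uu)
        have par: "even x = even y" using eq by (auto split: if_splits; presburger)
        show "x = y"
        proof (cases "even x")
          case True
          then have "g (x div 2) = g (y div 2)" using eq par by simp
          then have "x div 2 = y div 2"
            using g(1) in_w xy True par by (auto simp: bij_betw_def dest: inj_onD)
          then show ?thesis using par by presburger
        next
          case False
          then show ?thesis using eq par by simp
        qed
      qed
    qed (use g in \<open>auto simp: nw_mult_def uu\<close>)
    then show ?thesis ..
  next
    case 2
    then have "p = q" using homotopy_move_fst uu by fastforce
    moreover have "homotopy_move \<tau> (P, [] @ map f w @ R) (P, [] @ map f w' @ R)"
      using homotopy_move_context[OF _ f] 2 uu P by blast
    ultimately show ?thesis by (simp add: m m')
  next
    case 3
    then have "p = q" using surgery_fst uu by fastforce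
    moreover have "surgery \<alpha> \<tau> (P, map f w @ R) (P, map f w' @ R)"
      using surgery_map[OF _ f _ R] 3 uu P by blast
    ultimately show ?thesis by (simp add: m m')
  qed
  then show ?thesis using N by (simp add: cob_step_def)
qed

lemma cob_step_mult_right:
  assumes st: "cob_step \<alpha> \<tau> u u'" and v: "v \<in> nanowords \<alpha>"
  shows "cob_step \<alpha> \<tau> (nw_mult v u) (nw_mult v u')"
proof -
  obtain p w q w' where uu: "u = (p, w)" "u' = (q, w')" by fastforce
  have N: "nw_mult v u \<in> nanowords \<alpha>" "nw_mult v u' \<in> nanowords \<alpha>"
    using st v by (auto simp: cob_step_def intro: nw_mult_closed)
  define f where "f = (\<lambda>n::nat. 2 * n + 1)"
  define L where "L = map (\<lambda>n. 2 * n) (snd v)"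
  define P where "P = (\<lambda>n. if even n then fst v (n div 2) else p (n div 2))"
  have f: "inj f" by (auto simp: f_def inj_def)
  have P: "P (f a) = p a" for a by (simp add: P_def f_def)
  have L: "set L \<inter> set (map f x) = {}" for x unfolding L_def f_def by (auto, presburger)
  have m: "nw_mult v u = (P, L @ map f w)" by (simp add: fun_eq_iff nw_mult_def uu P_def L_def f_def)
  have m': "nw_mult v u' = (P, L @ map f w')" if "p = q"
    using that by (simp add: fun_eq_iff nw_mult_def uu P_def L_def f_def)
  consider "nw_iso u u'" | "homotopy_move \<tau> u u'" | "surgery \<alpha> \<tau> u u'"
    using st by (auto simp: cob_step_def)
  then have "nw_iso (nw_mult v u) (nw_mult v u') \<or> homotopy_move \<tau> (nw_mult v u) (nw_mult v u')
    \<or> surgery \<alpha> \<tau> (nw_mult v u) (nw_mult v u')"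
  proof cases
    case 1
    then obtain g where g: "bij_betw g (set w) (set w')" "w' = map g w" "\<forall>A\<in>set w. q (g A) = p A"
      by (auto simp: nw_iso_def uu)
    have "nw_iso (nw_mult v u) (nw_mult v u')"
    proof (rule nw_isoI[of "\<lambda>n. if even n then n else 2 * g (n div 2) + 1"])
      show "inj_on (\<lambda>n. if even n then n else 2 * g (n div 2) + 1) (set (snd (nw_mult v u)))"
      proof (rule inj_onI)
        fix x y
        assume xy: "x \<in> set (snd (nw_mult v u))" "y \<in> set (snd (nw_mult v u))"
          and eq: "(if even x then x else 2 * g (x div 2) + 1) = (if even y then y else 2 * g (y div 2) + 1)"
        have in_w: "n div 2 \<in> set w" if "n \<in> set (snd (nw_mult v u))" "odd n" for n
          using that by (auto simp: nw_mult_def uu)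
        have par: "even x = even y" using eq by (auto split: if_splits; presburger)
        show "x = y"
        proof (cases "odd x")
          case True
          then have "g (x div 2) = g (y div 2)" using eq par by simp
          then have "x div 2 = y div 2"
            using g(1) in_w xy True par by (auto simp: bij_betw_def dest: inj_onD)
          then show ?thesis using par by presburger
        next
          case False
          then show ?thesis using eq par by simp
        qed
      qed
    qed (use g in \<open>auto simp: nw_mult_def uu\<close>)
    then show ?thesis ..
  next
    case 2
    then have "p = q" using homotopy_move_fst uu by fastforce
    moreover have "homotopy_move \<tau> (P, L @ map f w @ []) (P, L @ map f w' @ [])"
      using homotopy_move_context[OF _ f] 2 uu P by blast
    ultimately show ?thesis by (simp add: m m')
  next
    case 3
    then have "p = q" using surgery_fst uu by fastforce
    moreover have "surgery \<alpha> \<tau> (P, map f w @ []) (P, map f w' @ [])"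
      using surgery_map[OF _ f, of \<alpha> \<tau> p w q w' P "[]"] 3 uu P by simp
    then have "surgery \<alpha> \<tau> (P, L @ map f w) (P, L @ map f w')"
      using surgery_prefix[OF _ L] by simp
    ultimately show ?thesis by (simp add: m m')
  qed
  then show ?thesis using N by (simp add: cob_step_def)
qed

lemma cobordism_transfer:
  assumes "(u, u') \<in> cobordism \<alpha> \<tau>"
    and "\<And>a b. cob_step \<alpha> \<tau> a b \<Longrightarrow> cob_step \<alpha> \<tau> (F a) (F b)"
    and "\<And>a. a \<in> nanowords \<alpha> \<Longrightarrow> F a \<in> nanowords \<alpha>"
  shows "(F u, F u') \<in> cobordism \<alpha> \<tau>"
proof -
  have "equivclp (cob_step \<alpha> \<tau>) u u'" using assms(1) by (simp add: cobordism_def)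
  then have "equivclp (cob_step \<alpha> \<tau>) (F u) (F u')"
  proof (induction rule: equivclp_induct)
    case base
    show ?case by simp
  next
    case (step y z)
    then have "equivclp (cob_step \<alpha> \<tau>) (F y) (F z)"
      using assms(2) by (meson equivclp_sym r_into_equivclp)
    with step show ?case by (meson equivclp_trans)
  qed
  then show ?thesis using assms(1,3) by (simp add: cobordism_def)
qed

lemma nw_mult_congruent2:
  "(\<lambda>u v. cobordism \<alpha> \<tau> `` {nw_mult u v}) respects2 cobordism \<alpha> \<tau>"
proof (rule congruent2I[OF equiv_cobordism equiv_cobordism])
  fix y z w :: "(nat, 'a) nanoword"
  assume w: "w \<in> nanowords \<alpha>" and yz: "(y, z) \<in> cobordism \<alpha> \<tau>"
  show "cobordism \<alpha> \<tau> `` {nw_mult y w} = cobordism \<alpha> \<tau> `` {nw_mult z w}"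
    by (rule equiv_class_eq[OF equiv_cobordism], rule cobordism_transfer[OF yz])
      (use w in \<open>auto intro: cob_step_mult_left nw_mult_closed\<close>)
  show "cobordism \<alpha> \<tau> `` {nw_mult w y} = cobordism \<alpha> \<tau> `` {nw_mult w z}"
    by (rule equiv_class_eq[OF equiv_cobordism], rule cobordism_transfer[OF yz])
      (use w in \<open>auto intro: cob_step_mult_right nw_mult_closed\<close>)
qed

lemma cobordism_group_mult_class:
  assumes "u \<in> nanowords \<alpha>" "v \<in> nanowords \<alpha>"
  shows "(cobordism \<alpha> \<tau> `` {u}) \<otimes>\<^bsub>cobordism_group \<alpha> \<tau>\<^esub> (cobordism \<alpha> \<tau> `` {v})
       = cobordism \<alpha> \<tau> `` {nw_mult u v}"
  using UN_equiv_class2[OF equiv_cobordism equiv_cobordism nw_mult_congruent2 assms, of \<tau>]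
  by (simp add: cobordism_group_def)

lemma nw_empty_closed: "nw_empty \<in> nanowords \<alpha>"
  by (simp add: nanowords_def nw_empty_def)

lemma count_list_rev: "count_list (rev w) a = count_list w a"
  by (induction w) auto

lemma nw_opposite_closed: "u \<in> nanowords \<alpha> \<Longrightarrow> nw_opposite u \<in> nanowords \<alpha>"
  by (auto simp: nanowords_def nw_opposite_def count_list_rev)

lemma nw_mult_assoc:
  "nw_iso (nw_mult (nw_mult u v) w) (nw_mult u (nw_mult v w))"
proof (rule nw_isoI[of "\<lambda>n. if odd n then 2 * n + 1 else if 4 dvd n then n div 2 else n - 1"])
  have d: "4 dvd 4 * x" "\<not> 4 dvd Suc (Suc (4 * x))" for x :: nat by presburger+
  show "inj_on (\<lambda>n. if odd n then 2 * n + 1 else if 4 dvd n then n div 2 else n - 1)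
     (set (snd (nw_mult (nw_mult u v) w)))"
  proof (rule inj_on_inverseI
      [of _ "\<lambda>m. if even m then 2 * m else if 4 dvd m - 1 then m + 1 else (m - 1) div 2"])
    fix x :: nat
    have "(\<exists>i. x = 4 * i) \<or> (\<exists>i. x = 4 * i + 2) \<or> (\<exists>i. x = 2 * i + 1)"
      by presburger
    then show "(if even (if odd x then 2 * x + 1 else if 4 dvd x then x div 2 else x - 1)
        then 2 * (if odd x then 2 * x + 1 else if 4 dvd x then x div 2 else x - 1)
        else if 4 dvd (if odd x then 2 * x + 1 else if 4 dvd x then x div 2 else x - 1) - 1
        then (if odd x then 2 * x + 1 else if 4 dvd x then x div 2 else x - 1) + 1
        else ((if odd x then 2 * x + 1 else if 4 dvd x then x div 2 else x - 1) - 1) div 2) = x"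
      by (elim disjE exE) (simp_all add: d)
  qed
  show "snd (nw_mult u (nw_mult v w)) =
    map (\<lambda>n. if odd n then 2 * n + 1 else if 4 dvd n then n div 2 else n - 1)
     (snd (nw_mult (nw_mult u v) w))"
    by (auto simp: nw_mult_def d)
  have q: "Suc (4 * x) div 2 = 2 * x" "Suc (4 * x) div 4 = x" for x :: nat by presburger+
  show "\<And>A. A \<in> set (snd (nw_mult (nw_mult u v) w)) \<Longrightarrow>
    fst (nw_mult u (nw_mult v w))
      (if odd A then 2 * A + 1 else if 4 dvd A then A div 2 else A - 1) =
    fst (nw_mult (nw_mult u v) w) A"
    by (auto simp: nw_mult_def d q)
qed

lemma nw_mult_empty: "nw_iso (nw_mult nw_empty u) u"
  by (rule nw_isoI[of "\<lambda>n. n div 2"]) (auto simp: nw_mult_def nw_empty_def inj_on_def comp_def)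

lemma nw_mult_opposite:
  assumes u: "u \<in> nanowords \<alpha>"
  shows "(nw_mult (nw_opposite u) u, nw_empty) \<in> cobordism \<alpha> \<tau>"
proof -
  define P where "P = (\<lambda>n. fst u (n div 2))"
  define v where "v = map (\<lambda>n. 2 * n) (rev (snd u)) @ map (\<lambda>n. 2 * n + 1) (snd u)"
  have m: "nw_mult (nw_opposite u) u = (P, v)"
    by (auto simp: nw_mult_def nw_opposite_def P_def v_def)
  have N: "(P, v) \<in> nanowords \<alpha>"
    using nw_mult_closed[OF nw_opposite_closed[OF u] u] by (simp add: m)
  let ?i = "\<lambda>n::nat. if even n then n + 1 else n - 1"
  have rv: "map ?i v = rev v" by (simp add: v_def rev_map)
  have "inj_on ?i (set v)" by (auto simp: inj_on_def; presburger)
  moreover have "?i ` set v = set v" by (metis rv set_map set_rev)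
  ultimately have "bij_betw ?i (set v) (set v)" by (simp add: bij_betw_def)
  moreover have "phrase_eps [v] B = 0" if "B \<in> set v" for B
    using N that by (auto simp: phrase_eps_def nanowords_def)
  moreover have "P (?i B) = P B" for B by (auto simp: P_def elim!: oddE)
  ultimately have s: "symmetric_phrase \<tau> P [v]"
    unfolding symmetric_phrase_def using rv by (intro exI[of _ ?i]) auto
  have "surgery \<alpha> \<tau> (P, concat (map2 (@) [[]] [v]) @ []) (P, concat [[]] @ [])"
    by (rule surgery.intros) (use N s in \<open>auto simp: nanophrase_def even_phrase_def v_def\<close>)
  then have s1: "cob_step \<alpha> \<tau> (P, v) (P, [])"
    using N by (auto simp: cob_step_def nanowords_def)
  have "cob_step \<alpha> \<tau> (P, []) nw_empty"
    by (auto simp: cob_step_def nanowords_def nw_empty_def nw_iso_def)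
  with s1 show ?thesis
    unfolding m by (meson cob_stepI equiv_cobordism equivE transE)
qed

theorem cobordism_group_group: "group (cobordism_group \<alpha> \<tau>)"
proof (rule groupI)
  let ?G = "cobordism_group \<alpha> \<tau>" and ?c = "\<lambda>u :: (nat, 'a) nanoword. cobordism \<alpha> \<tau> `` {u}"
  have car: "carrier ?G = nanowords \<alpha> // cobordism \<alpha> \<tau>" by (simp add: cobordism_group_def)
  have one: "\<one>\<^bsub>?G\<^esub> = ?c nw_empty" by (simp add: cobordism_group_def)
  have cI: "?c u \<in> carrier ?G" if "u \<in> nanowords \<alpha>" for u
    using that by (auto simp: car intro: quotientI)
  have iso: "?c u = ?c v" if "nw_iso u v" "u \<in> nanowords \<alpha>" "v \<in> nanowords \<alpha>" for u v
    using that by (auto intro!: equiv_class_eq[OF equiv_cobordism] cob_stepI simp: cob_step_def)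
  note mult = cobordism_group_mult_class
  show "\<one>\<^bsub>?G\<^esub> \<in> carrier ?G" using cI[OF nw_empty_closed] one by simp
  fix x assume "x \<in> carrier ?G"
  then obtain u where u: "u \<in> nanowords \<alpha>" "x = ?c u" by (auto simp: car elim: quotientE)
  show "\<one>\<^bsub>?G\<^esub> \<otimes>\<^bsub>?G\<^esub> x = x"
    using u by (simp add: one mult nw_empty_closed iso[OF nw_mult_empty] nw_mult_closed)
  show "\<exists>y\<in>carrier ?G. y \<otimes>\<^bsub>?G\<^esub> x = \<one>\<^bsub>?G\<^esub>"
    using u by (intro bexI[of _ "?c (nw_opposite u)"])
      (auto simp: one mult nw_opposite_closed cI
        intro!: equiv_class_eq[OF equiv_cobordism] nw_mult_opposite)
  fix y assume "y \<in> carrier ?G"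
  then obtain v where v: "v \<in> nanowords \<alpha>" "y = ?c v" by (auto simp: car elim: quotientE)
  show "x \<otimes>\<^bsub>?G\<^esub> y \<in> carrier ?G" using u v by (simp add: mult cI nw_mult_closed)
  fix z assume "z \<in> carrier ?G"
  then obtain w where w: "w \<in> nanowords \<alpha>" "z = ?c w" by (auto simp: car elim: quotientE)
  show "x \<otimes>\<^bsub>?G\<^esub> y \<otimes>\<^bsub>?G\<^esub> z = x \<otimes>\<^bsub>?G\<^esub> (y \<otimes>\<^bsub>?G\<^esub> z)"
    using u v w by (simp add: mult nw_mult_closed iso[OF nw_mult_assoc])
qed

end

theory Submission
  imports Defs
begin

text \<open>
  Let every letter \<open>c\<close> of \<open>\<alpha>\<close> act on a set by a permutation \<open>F c\<close> such that \<open>F (\<tau> c)\<close> is inverse to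
  \<open>F c\<close>. Reading a nanoword from left to right, compose \<open>F |A|\<close> for the first and \<open>F (\<tau> |A|)\<close> for
  the second occurrence of every letter \<open>A\<close>. The result is multiplicative and invariant under
  cobordism: in an even symmetric factor the permutations at mirror positions of each \<open>v\<^sub>r\<close> are
  mutually inverse, so that they cancel from the middle outwards. Since \<open>ABAB\<close> goes to a commutator
  and \<open>XwX\<close> to a conjugate of the image of \<open>w\<close>, it remains to choose suitable actions: the infinite
  dihedral group for infiniteness, the lamplighter group for infinite generation (the image is an
  infinite subgroup of the base, which is locally finite), and groups generated by transpositions
  and possibly a shift for non-commutativity.
\<close>

section \<open>The invariant\<close>

text \<open>The set \<open>R\<close> contains the letters of the word that follows \<open>w\<close>.\<close>

fun signed_word :: "('a \<Rightarrow> 'a) \<Rightarrow> ('l \<Rightarrow> 'a) \<Rightarrow> 'l set \<Rightarrow> 'l list \<Rightarrow> 'a list" where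
  "signed_word \<tau> p R [] = []"
| "signed_word \<tau> p R (A # w) =
     (if A \<in> set w \<union> R then p A else \<tau> (p A)) # signed_word \<tau> p R w"

definition compose_list :: "('a \<Rightarrow> 'x \<Rightarrow> 'x) \<Rightarrow> 'a list \<Rightarrow> 'x \<Rightarrow> 'x" where
  "compose_list F cs = foldr (\<lambda>c g. F c \<circ> g) cs id"

lemma compose_list_simps [simp]:
  "compose_list F [] = id"
  "compose_list F (c # cs) = F c \<circ> compose_list F cs"
  by (simp_all add: compose_list_def)

lemma compose_list_append: "compose_list F (cs @ ds) = compose_list F cs \<circ> compose_list F ds"
  by (induction cs) (auto simp: comp_assoc)

lemma length_signed_word [simp]: "length (signed_word \<tau> p R w) = length w"
  by (induction w) auto

lemma signed_word_append:
  "signed_word \<tau> p R (v @ w) = signed_word \<tau> p (set w \<union> R) v @ signed_word \<tau> p R w"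
  by (induction v) auto

text \<open>Membership in \<open>R\<close> is only ever asked for letters of \<open>w\<close>, so
  foreign letters may be dropped from \<open>R\<close>.\<close>

lemma signed_word_cong:
  assumes "R \<inter> set w = R' \<inter> set w"
  shows "signed_word \<tau> p R w = signed_word \<tau> p R' w"
  using assms by (induction w) auto

lemma signed_word_map:
  assumes "inj_on f (set w)" "\<And>A. A \<in> set w \<Longrightarrow> q (f A) = p A"
  shows "signed_word \<tau> q {} (map f w) = signed_word \<tau> p {} w"
  using assms by (induction w) auto

lemma signed_word_nth:
  "i < length w \<Longrightarrow> signed_word \<tau> p R w ! i =
     (if w ! i \<in> set (drop (Suc i) w) \<union> R then p (w ! i) else \<tau> (p (w ! i)))"
  by (induction w arbitrary: i) (auto simp: nth_Cons split: nat.split)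

section \<open>Mirror symmetry of the signed letters in a symmetric factor\<close>

lemma count_list_card: "count_list w A = card {i. i < length w \<and> w ! i = A}"
proof (induction w)
  case (Cons B w)
  have "{i. i < length (B # w) \<and> (B # w) ! i = A} =
    (if B = A then {0} else {}) \<union> Suc ` {i. i < length w \<and> w ! i = A}"
    by (auto simp: less_Suc_eq_0_disj)
  moreover have "card (Suc ` {i. i < length w \<and> w ! i = A}) = card {i. i < length w \<and> w ! i = A}"
    by (rule card_image) simp
  ultimately show ?case
    using Cons by (simp add: card_insert_if image_iff)
qed simp

lemma in_set_drop_iff: "A \<in> set (drop k w) \<longleftrightarrow> (\<exists>j\<ge>k. j < length w \<and> w ! j = A)"
proof -
  have "A \<in> set (drop k w) \<longleftrightarrow> (\<exists>i. k + i < length w \<and> w ! (k + i) = A)"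
    by (auto simp: in_set_conv_nth less_diff_conv add.commute)
  then show ?thesis by (auto simp: le_iff_add)
qed

text \<open>The position opposite to one with letter \<open>B\<close> carries
  \<open>\<iota> B\<close>. If both occurrences of \<open>B\<close> lie in \<open>v\<close>,
  reflection exchanges first and second occurrence and the projection is unchanged. Otherwise the
  projection is twisted by \<tau>, and the other occurrences of \<open>B\<close> and
  \<open>\<iota> B\<close> lie on the same side of \<open>v\<close>. Either way the signed letter
  changes by \<tau>.\<close>

lemma symmetric_phrase_signed_word:
  assumes n: "nanophrase \<alpha> p (vs1 @ v # vs2)" and s: "symmetric_phrase \<tau> p (vs1 @ v # vs2)"
    and tau: "\<And>a. a \<in> \<alpha> \<Longrightarrow> \<tau> (\<tau> a) = a"
  defines "L \<equiv> signed_word \<tau> p (set (concat vs2)) v"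
  shows "rev L = map \<tau> L"
proof (rule nth_equalityI)
  let ?vs = "vs1 @ v # vs2" and ?R = "set (concat vs2)" and ?n = "length v"
  show "length (rev L) = length (map \<tau> L)" by simp
  obtain \<iota> where bij: "bij_betw \<iota> (set (concat ?vs)) (set (concat ?vs))"
    and rv: "\<And>v. v \<in> set ?vs \<Longrightarrow> map \<iota> v = rev v"
    and p: "\<And>B. B \<in> set (concat ?vs) \<Longrightarrow> p (\<iota> B) = (\<tau> ^^ phrase_eps ?vs B) (p B)"
    using s unfolding symmetric_phrase_def by blast
  have inj: "\<iota> A = \<iota> B \<longleftrightarrow> A = B" if "A \<in> set (concat ?vs)" "B \<in> set (concat ?vs)" for A B
    using bij that by (auto simp: bij_betw_def dest: inj_onD)
  have rvn: "v ! (?n - Suc i) = \<iota> (v ! i)" if "i < ?n" for i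
    using rv[of v] that by (metis in_set_conv_decomp nth_map rev_nth)
  fix i assume "i < length (rev L)"
  then have i: "i < ?n" by (simp add: L_def)
  define B where "B = v ! i"
  define i' where "i' = ?n - Suc i"
  have i': "i' < ?n" using i by (simp add: i'_def)
  have Bv: "B \<in> set v" using i by (simp add: B_def)
  then have Bc: "B \<in> set (concat ?vs)" by simp
  have vi': "v ! i' = \<iota> B" using rvn[OF i] by (simp add: i'_def B_def)
  have pB: "p B \<in> \<alpha>" and cB: "count_list (concat ?vs) B = 2"
    using n Bc by (auto simp: nanophrase_def nanowords_def)
  have tot: "count_list (concat vs1) B + (count_list v B + count_list (concat vs2) B) = 2"
    using cB by simp
  \<comment> \<open>Occurrences of \<open>\<iota> B\<close> to the right of \<open>i'\<close> are
    mirror images of occurrences of \<open>B\<close> to the left of \<open>i\<close>.\<close>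
  have later: "\<iota> B \<in> set (drop (Suc i') v) \<longleftrightarrow> (\<exists>j<i. v ! j = B)"
  proof -
    have "\<iota> B \<in> set (drop (Suc i') v) \<longleftrightarrow> (\<exists>j>i'. j < ?n \<and> v ! j = \<iota> B)"
      by (auto simp: in_set_drop_iff Suc_le_eq)
    also have "\<dots> \<longleftrightarrow> (\<exists>j<i. v ! (?n - Suc j) = \<iota> B)"
    proof
      assume "\<exists>j>i'. j < ?n \<and> v ! j = \<iota> B"
      then obtain j where "j > i'" "j < ?n" "v ! j = \<iota> B" by blast
      then show "\<exists>j<i. v ! (?n - Suc j) = \<iota> B"
        using i by (intro exI[of _ "?n - Suc j"]) (auto simp: i'_def)
    next
      assume "\<exists>j<i. v ! (?n - Suc j) = \<iota> B"
      then obtain j where "j < i" "v ! (?n - Suc j) = \<iota> B" by blast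
      then show "\<exists>j>i'. j < ?n \<and> v ! j = \<iota> B"
        using i by (intro exI[of _ "?n - Suc j"]) (auto simp: i'_def)
    qed
    also have "\<dots> \<longleftrightarrow> (\<exists>j<i. v ! j = B)"
    proof -
      have "v ! (?n - Suc j) = \<iota> B \<longleftrightarrow> v ! j = B" if "j < i" for j
        using rvn[of j] inj[of "v ! j" B] Bc that i by auto
      then show ?thesis by blast
    qed
    finally show ?thesis .
  qed
  have nth: "L ! i = (if B \<in> set (drop (Suc i) v) \<union> ?R then p B else \<tau> (p B))"
    "L ! i' = (if \<iota> B \<in> set (drop (Suc i') v) \<union> ?R then p (\<iota> B) else \<tau> (p (\<iota> B)))"
    using signed_word_nth[OF i, of \<tau> p ?R] signed_word_nth[OF i', of \<tau> p ?R]
    by (simp_all add: L_def B_def vi'[unfolded B_def])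
  \<comment> \<open>Since \<open>map \<iota> v' = rev v'\<close>, the letter set of every later word
    is stable under \<iota>.\<close>
  have R: "\<iota> B \<in> ?R \<longleftrightarrow> B \<in> ?R"
  proof -
    have "\<iota> B \<in> set v' \<longleftrightarrow> B \<in> set v'" if "v' \<in> set vs2" for v'
    proof -
      have "\<iota> ` set v' = set v'" using rv[of v'] that by (metis Un_iff insert_iff list.simps(15) set_append set_map set_rev)
      moreover have "set v' \<subseteq> set (concat ?vs)" using that by auto
      ultimately show ?thesis using inj[OF _ Bc] by (metis imageE imageI subsetD)
    qed
    then show ?thesis by auto
  qed
  let ?P = "{j. j < ?n \<and> v ! j = B}"
  have card: "card ?P = count_list v B" by (simp add: count_list_card)
  have iP: "i \<in> ?P" "finite ?P" using i by (auto simp: B_def)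
  have "L ! i' = \<tau> (L ! i)"
  proof (cases "count_list v B = 2")
    case True
    then have "B \<notin> ?R" using tot by (simp add: count_list_0_iff)
    have "phrase_eps ?vs B = 0" using True by (auto simp: phrase_eps_def)
    then have pi: "p (\<iota> B) = p B" using p[OF Bc] by simp
    obtain j where j: "?P = {i, j}" "i \<noteq> j"
      using True iP card by (metis (no_types, lifting) card_2_iff doubleton_eq_iff insertE singletonD)
    have j': "k < ?n \<and> v ! k = B \<longleftrightarrow> k = i \<or> k = j" for k
      using j(1) by blast
    have "B \<in> set (drop (Suc i) v) \<longleftrightarrow> i < j"
      using j' by (auto simp: in_set_drop_iff Suc_le_eq)
    moreover have "(\<exists>k<i. v ! k = B) \<longleftrightarrow> j < i"
      using j' i by (metis less_trans nat_neq_iff)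
    ultimately show ?thesis
      using nth later R \<open>B \<notin> ?R\<close> pi tau[OF pB] j(2) by auto
  next
    case False
    moreover have "count_list v B \<noteq> 0" using Bv by (simp add: count_list_0_iff)
    ultimately have one: "count_list v B = 1" using tot by linarith
    \<comment> \<open>As \<open>v\<close> holds \<open>B\<close> once, another word holding it twice
      would bring its total above 2.\<close>
    have "count_list v' B \<noteq> 2" if "v' \<in> set ?vs" for v'
    proof
      assume c: "count_list v' B = 2"
      have le: "count_list v' B \<le> count_list (concat us) B" if "v' \<in> set us" for us
        using that by (induction us) auto
      from that consider "v' = v" | "v' \<in> set vs1" | "v' \<in> set vs2" by auto
      then show False using c one tot le[of vs1] le[of vs2] by cases auto
    qed
    then have "phrase_eps ?vs B = 1" unfolding phrase_eps_def by auto
    then have pi: "p (\<iota> B) = \<tau> (p B)" using p[OF Bc] by simp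
    have "?P = {i}" using one card iP by (metis card_1_singletonE singletonD)
    then have j': "k < ?n \<and> v ! k = B \<longleftrightarrow> k = i" for k by blast
    have "B \<notin> set (drop (Suc i) v)"
      using j' by (auto simp: in_set_drop_iff Suc_le_eq)
    moreover have "\<not> (\<exists>k<i. v ! k = B)"
      using j' i by (metis less_trans nat_neq_iff)
    ultimately show ?thesis
      using nth later R pi by auto
  qed
  then show "rev L ! i = map \<tau> L ! i"
    using i by (simp add: rev_nth L_def i'_def)
qed

section \<open>Permutation actions and cobordism invariance\<close>

locale inverse_action =
  fixes \<alpha> :: "'a set" and \<tau> :: "'a \<Rightarrow> 'a" and F :: "'a \<Rightarrow> 'x \<Rightarrow> 'x"
  assumes tau_closed: "a \<in> \<alpha> \<Longrightarrow> \<tau> a \<in> \<alpha>"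
    and tau_tau: "a \<in> \<alpha> \<Longrightarrow> \<tau> (\<tau> a) = a"
    and action_tau: "a \<in> \<alpha> \<Longrightarrow> F a (F (\<tau> a) x) = x"
begin

definition word_action :: "('l \<Rightarrow> 'a) \<Rightarrow> 'l set \<Rightarrow> 'l list \<Rightarrow> 'x \<Rightarrow> 'x" where
  "word_action p R w = compose_list F (signed_word \<tau> p R w)"

definition nw_action :: "('l, 'a) nanoword \<Rightarrow> 'x \<Rightarrow> 'x" where
  "nw_action u = word_action (fst u) {} (snd u)"

text \<open>Taking \<open>action_tau\<close> at \<open>\<tau> a\<close> supplies the inverse on the
  other side, so \<open>F a\<close> is a bijection.\<close>

lemma tau_action: "a \<in> \<alpha> \<Longrightarrow> F (\<tau> a) (F a x) = x"
  using action_tau[of "\<tau> a" x] by (simp add: tau_closed tau_tau)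

lemma word_action_Nil [simp]: "word_action p R [] = id"
  by (simp add: word_action_def)

lemma word_action_Cons [simp]:
  "word_action p R (A # w) = F (if A \<in> set w \<union> R then p A else \<tau> (p A)) \<circ> word_action p R w"
  by (simp add: word_action_def)

lemma word_action_append:
  "word_action p R (v @ w) = word_action p (set w \<union> R) v \<circ> word_action p R w"
  by (simp add: word_action_def signed_word_append compose_list_append)

lemma word_action_cong:
  "R \<inter> set w = R' \<inter> set w \<Longrightarrow> word_action p R w = word_action p R' w"
  unfolding word_action_def by (metis signed_word_cong)

lemma compose_list_mirror:
  "set cs \<subseteq> \<alpha> \<Longrightarrow> compose_list F (cs @ rev (map \<tau> cs)) = id"
proof (induction cs)
  case (Cons c cs)
  have "compose_list F (cs @ rev (map \<tau> cs)) = id"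
    by (rule Cons.IH) (use Cons.prems in auto)
  then have "compose_list F ((c # cs) @ rev (map \<tau> (c # cs))) = F c \<circ> F (\<tau> c)"
    by (simp add: compose_list_append fun_eq_iff)
  moreover have "F c \<circ> F (\<tau> c) = id" using Cons.prems action_tau by (simp add: fun_eq_iff)
  ultimately show ?case by metis
qed simp

text \<open>Even length excludes a middle letter \<open>c\<close>: it would satisfy
  \<open>\<tau> c = c\<close>, which makes \<open>F c\<close> an involution but not the identity.
  The second half is then the mirror of the first and cancels it.\<close>

lemma compose_list_palindrome:
  assumes "rev cs = map \<tau> cs" "even (length cs)" "set cs \<subseteq> \<alpha>"
  shows "compose_list F cs = id"
proof -
  let ?h = "length cs div 2"
  have "rev (drop ?h cs) = take ?h (rev cs)"
    using assms(2) by (auto simp: take_rev elim!: evenE)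
  then have "rev (drop ?h cs) = map \<tau> (take ?h cs)"
    by (simp add: assms(1) take_map)
  then have "drop ?h cs = rev (map \<tau> (take ?h cs))"
    by (metis rev_rev_ident)
  then have "cs = take ?h cs @ rev (map \<tau> (take ?h cs))"
    by (metis append_take_drop_id)
  moreover have "set (take ?h cs) \<subseteq> \<alpha>" using assms(3) set_take_subset by fastforce
  ultimately show ?thesis using compose_list_mirror by metis
qed

lemma set_signed_word: "(\<And>A. A \<in> set w \<Longrightarrow> p A \<in> \<alpha>) \<Longrightarrow> set (signed_word \<tau> p R w) \<subseteq> \<alpha>"
  by (induction w) (auto simp: tau_closed)

text \<open>The letter sets of factor and surroundings are disjoint. Hence signs inside a word of
  the factor depend only on that word and the later words of the factor, so that it acts trivially,
  and removing the whole factor disturbs no sign in the surroundings.\<close>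

lemma word_action_remove_factor:
  assumes "length xs = length vs" "set (concat xs @ z) \<inter> set (concat vs) = {}"
    and "\<And>vs1 v vs2. vs = vs1 @ v # vs2 \<Longrightarrow> word_action p (set (concat vs2)) v = id"
  shows "word_action p {} (concat (map2 (@) xs vs) @ z) = word_action p {} (concat xs @ z)"
  using assms
proof (induction xs vs rule: list_induct2)
  case (Cons x xs v vs)
  define w where "w = concat (map2 (@) xs vs) @ z"
  define w' where "w' = concat xs @ z"
  have "set (concat (map2 (@) xs vs)) = set (concat xs) \<union> set (concat vs)"
    using Cons.hyps by (induction xs vs rule: list_induct2) auto
  then have sw: "set w = set w' \<union> set (concat vs)"
    unfolding w_def w'_def by auto
  have disj: "(set x \<union> set w') \<inter> (set v \<union> set (concat vs)) = {}"
    using Cons.prems(1) unfolding w'_def by auto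
  have IH: "word_action p {} w = word_action p {} w'"
    unfolding w_def w'_def
  proof (rule Cons.IH)
    show "set (concat xs @ z) \<inter> set (concat vs) = {}" using Cons.prems(1) by auto
    show "word_action p (set (concat vs2)) u = id" if "vs = vs1 @ u # vs2" for vs1 u vs2
      by (rule Cons.prems(2)[of "v # vs1"]) (simp add: that)
  qed
  have "word_action p (set w) v = word_action p (set (concat vs)) v"
    by (rule word_action_cong) (use disj sw in blast)
  also have "\<dots> = id"
    by (rule Cons.prems(2)[of "[]"]) simp
  finally have v: "word_action p (set w) v = id" .
  have x: "word_action p (set (v @ w)) x = word_action p (set w') x"
    by (rule word_action_cong) (use disj in \<open>unfold set_append[of v] sw, blast\<close>)
  have "word_action p {} (x @ v @ w) =
      word_action p (set (v @ w)) x \<circ> (word_action p (set w) v \<circ> word_action p {} w)"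
    by (simp only: word_action_append Un_empty_right)
  also have "\<dots> = word_action p {} (x @ w')"
    unfolding IH v x by (simp only: word_action_append Un_empty_right id_comp)
  finally show ?case unfolding w_def w'_def by simp
qed simp

lemma nw_action_surgery:
  assumes "surgery \<alpha> \<tau> u u'"
  shows "nw_action u = nw_action u'"
  using assms
proof cases
  case (1 p vs xs z)
  have "word_action p (set (concat vs2)) v = id" if "vs = vs1 @ v # vs2" for vs1 v vs2
    unfolding word_action_def
  proof (rule compose_list_palindrome)
    show "rev (signed_word \<tau> p (set (concat vs2)) v) = map \<tau> (signed_word \<tau> p (set (concat vs2)) v)"
      using 1 that symmetric_phrase_signed_word tau_tau by metis
    show "even (length (signed_word \<tau> p (set (concat vs2)) v))"
      using 1 that by (simp add: even_phrase_def)
    show "set (signed_word \<tau> p (set (concat vs2)) v) \<subseteq> \<alpha>"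
      using 1(3) that by (intro set_signed_word) (auto simp: nanophrase_def nanowords_def)
  qed
  from word_action_remove_factor[OF 1(6,7) this] 1 show ?thesis
    by (simp add: nw_action_def)
qed

text \<open>Move 1 drops a permutation next to its inverse. In move 2 each of the blocks
  \<open>AB\<close> and \<open>BA\<close> acts trivially. In move 3 each outer block is a square of
  one permutation, and the middle block, made of one first and one second occurrence, is trivial in
  either order.\<close>

lemma nw_action_move:
  assumes "homotopy_move \<tau> u u'" and u: "u \<in> nanowords \<alpha>"
  shows "nw_action u = nw_action u'"
  using assms(1)
proof cases
  case (move1 p x A y)
  have "count_list (x @ [A, A] @ y) A = 2" "p A \<in> \<alpha>"
    using u unfolding move1 nanowords_def by auto
  then have A: "A \<notin> set x" "A \<notin> set y" "p A \<in> \<alpha>" by (auto simp: count_list_0_iff)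
  have "word_action p (set ([A, A] @ y)) x = word_action p (set y) x"
    using A by (intro word_action_cong) auto
  then show ?thesis
    using A action_tau by (simp add: move1 nw_action_def word_action_append fun_eq_iff)
next
  case (move2 p B A x y z)
  have c: "count_list (x @ [A, B] @ y @ [B, A] @ z) A = 2"
      "count_list (x @ [A, B] @ y @ [B, A] @ z) B = 2" and pA: "p A \<in> \<alpha>" "p B \<in> \<alpha>"
    using u unfolding move2(1) nanowords_def by auto
  \<comment> \<open>Equal letters would occur at least four times.\<close>
  have "A \<noteq> B" using c by auto
  then have A: "A \<notin> set (x @ y @ z)" "B \<notin> set (x @ y @ z)"
    using c by (auto simp: count_list_0_iff)
  have "word_action p (set ([A, B] @ y @ [B, A] @ z)) x = word_action p (set (y @ z)) x"
    using A by (intro word_action_cong) auto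
  moreover have "word_action p (set ([B, A] @ z)) y = word_action p (set z) y"
    using A by (intro word_action_cong) auto
  ultimately show ?thesis
    using A pA \<open>A \<noteq> B\<close> action_tau tau_action tau_tau
    by (simp add: move2 nw_action_def word_action_append fun_eq_iff)
next
  case (move3 A B C p x y z t)
  have c: "count_list (x @ [A, B] @ y @ [A, C] @ z @ [B, C] @ t) A = 2"
    "count_list (x @ [A, B] @ y @ [A, C] @ z @ [B, C] @ t) B = 2"
    "count_list (x @ [A, B] @ y @ [A, C] @ z @ [B, C] @ t) C = 2" and pA: "p A \<in> \<alpha>"
    using u unfolding move3 nanowords_def by auto
  have A: "A \<notin> set (x @ y @ z @ t)" "B \<notin> set (x @ y @ z @ t)" "C \<notin> set (x @ y @ z @ t)"
    using c move3 by (auto simp: count_list_0_iff)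
  have FA: "F (p A) (F (\<tau> (p A)) v) = v" "F (\<tau> (p A)) (F (p A) v) = v" for v
    using pA action_tau tau_action by auto
  have p: "p B = p A" "p C = p A" using move3 by auto
  show ?thesis
    using A \<open>distinct [A, B, C]\<close>
    by (auto simp add: move3(1,2) nw_action_def word_action_append fun_eq_iff FA p insert_commute)
qed

lemma nw_action_iso:
  assumes "nw_iso u u'"
  shows "nw_action u = nw_action u'"
  using assms signed_word_map[of _ "snd u" "fst u'" "fst u" \<tau>]
  by (auto simp: nw_iso_def nw_action_def word_action_def bij_betw_def)

theorem nw_action_cobordism:
  assumes "(u, u') \<in> cobordism \<alpha> \<tau>"
  shows "nw_action u = nw_action u'"
proof -
  have step: "nw_action a = nw_action b" if "cob_step \<alpha> \<tau> a b" for a b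
    using that nw_action_iso[of a b] nw_action_move[of a b] nw_action_surgery[of a b]
    unfolding cob_step_def by blast
  have "equivclp (cob_step \<alpha> \<tau>) u u'" using assms by (simp add: cobordism_def)
  then show ?thesis by (induction rule: equivclp_induct) (auto dest: step)
qed

lemma nw_action_class:
  assumes "cobordism \<alpha> \<tau> `` {u} = cobordism \<alpha> \<tau> `` {u'}" "u' \<in> nanowords \<alpha>"
  shows "nw_action u = nw_action u'"
  using assms eq_equiv_class[OF _ equiv_cobordism] nw_action_cobordism by metis

lemma nw_action_empty [simp]: "nw_action nw_empty = id"
  by (simp add: nw_action_def nw_empty_def)

text \<open>Letters of the left word are even and those of the right word odd, so the right word
  does not affect signs in the left one.\<close>

lemma nw_action_mult: "nw_action (nw_mult u v) = nw_action u \<circ> nw_action v"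
proof -
  let ?P = "\<lambda>n. if even n then fst u (n div 2) else fst v (n div 2)"
  let ?U = "map (\<lambda>n. 2 * n) (snd u)" and ?V = "map (\<lambda>n. 2 * n + 1) (snd v)"
  have "word_action ?P (set ?V) ?U = word_action ?P {} ?U"
    by (rule word_action_cong) (auto, presburger)
  moreover have "signed_word \<tau> ?P {} ?U = signed_word \<tau> (fst u) {} (snd u)"
    by (rule signed_word_map) (auto simp: inj_on_def)
  moreover have "signed_word \<tau> ?P {} ?V = signed_word \<tau> (fst v) {} (snd v)"
    by (rule signed_word_map) (auto simp: inj_on_def)
  ultimately show ?thesis
    by (simp add: nw_action_def nw_mult_def word_action_append) (simp add: word_action_def)
qed

end

section \<open>Commutators and conjugates\<close>

definition nw_commutator :: "'a \<Rightarrow> 'a \<Rightarrow> (nat, 'a) nanoword" where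
  "nw_commutator a b = (case_nat a (\<lambda>_. b), [0, 1, 0, 1])"

text \<open>The shift by \<open>Suc\<close> frees the letter 0 for the enclosing pair.\<close>

definition nw_conjugate :: "'a \<Rightarrow> (nat, 'a) nanoword \<Rightarrow> (nat, 'a) nanoword" where
  "nw_conjugate a u = (case_nat a (fst u), 0 # map Suc (snd u) @ [0])"

lemma nw_commutator_closed: "a \<in> \<alpha> \<Longrightarrow> b \<in> \<alpha> \<Longrightarrow> nw_commutator a b \<in> nanowords \<alpha>"
  by (auto simp: nanowords_def nw_commutator_def)

lemma nw_conjugate_closed:
  assumes "a \<in> \<alpha>" "u \<in> nanowords \<alpha>"
  shows "nw_conjugate a u \<in> nanowords \<alpha>"
proof -
  have "count_list (map Suc w) 0 = 0" for w by (simp add: count_list_0_iff)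
  then show ?thesis
    using assms by (auto simp: nanowords_def nw_conjugate_def count_list_map_inj)
qed

context inverse_action
begin

lemma nw_action_commutator:
  "nw_action (nw_commutator a b) = F a \<circ> F b \<circ> F (\<tau> a) \<circ> F (\<tau> b)"
  by (simp add: nw_action_def nw_commutator_def fun_eq_iff)

lemma nw_action_conjugate:
  "nw_action (nw_conjugate a u) = F a \<circ> nw_action u \<circ> F (\<tau> a)"
proof -
  have "signed_word \<tau> (case_nat a (fst u)) {} (map Suc (snd u)) = signed_word \<tau> (fst u) {} (snd u)"
    by (rule signed_word_map) auto
  moreover have "word_action (case_nat a (fst u)) {0} (map Suc (snd u))
      = word_action (case_nat a (fst u)) {} (map Suc (snd u))"
    by (rule word_action_cong) auto
  ultimately show ?thesis
    by (simp add: nw_action_def nw_conjugate_def word_action_append fun_eq_iff)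
      (simp add: word_action_def)
qed

text \<open>Since \<open>nw_action\<close> is multiplicative and constant on cobordism classes, it
  suffices to separate the two products at a single point.\<close>

lemma not_comm_groupI:
  fixes u v :: "(nat, 'a) nanoword"
  assumes "u \<in> nanowords \<alpha>" "v \<in> nanowords \<alpha>"
    and "(nw_action u \<circ> nw_action v) x \<noteq> (nw_action v \<circ> nw_action u) x"
  shows "\<not> comm_group (cobordism_group \<alpha> \<tau>)"
proof
  let ?G = "cobordism_group \<alpha> \<tau>" and ?c = "\<lambda>u :: (nat, 'a) nanoword. cobordism \<alpha> \<tau> `` {u}"
  assume "comm_group ?G"
  then interpret comm_group ?G .
  have "?c u \<in> carrier ?G" "?c v \<in> carrier ?G"
    using assms by (auto simp: cobordism_group_def intro: quotientI)
  then have "?c u \<otimes>\<^bsub>?G\<^esub> ?c v = ?c v \<otimes>\<^bsub>?G\<^esub> ?c u" by (rule m_comm)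
  then have "?c (nw_mult u v) = ?c (nw_mult v u)"
    using assms by (simp add: cobordism_group_mult_class)
  then have "nw_action (nw_mult u v) = nw_action (nw_mult v u)"
    using assms by (intro nw_action_class nw_mult_closed)
  then show False using assms(3) by (simp add: nw_action_mult)
qed

end

section \<open>Orbits\<close>

lemma orbit_involution:
  assumes "\<tau> (\<tau> a) = a"
  shows "orbit \<tau> a = {a, \<tau> a}"
proof
  show "orbit \<tau> a \<subseteq> {a, \<tau> a}"
  proof
    fix x assume "x \<in> orbit \<tau> a"
    then show "x \<in> {a, \<tau> a}" by induction (auto simp: assms)
  qed
  have "\<tau> a \<in> orbit \<tau> a" by (rule orbit.base)
  then show "{a, \<tau> a} \<subseteq> orbit \<tau> a" using orbit.step[of "\<tau> a" \<tau> a] by (simp add: assms)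
qed

text \<open>Pigeonhole: if every letter of \<alpha> lay in the orbit of some member of
  \<open>T\<close>, there would be at most \<open>card T\<close> orbits.\<close>

lemma ex_new_orbit:
  assumes "at_least_elems n (orbits_of \<alpha> \<tau>)" "\<And>a. a \<in> \<alpha> \<Longrightarrow> \<tau> (\<tau> a) = a"
    and "finite T" "card T < n" "T \<subseteq> \<alpha>"
  shows "\<exists>b\<in>\<alpha>. \<forall>a\<in>T. b \<noteq> a \<and> b \<noteq> \<tau> a"
proof (rule ccontr)
  assume no: "\<not> ?thesis"
  have "orbits_of \<alpha> \<tau> \<subseteq> orbit \<tau> ` T"
    unfolding orbits_of_def
  proof (rule image_subsetI)
    fix b assume "b \<in> \<alpha>"
    then obtain a where a: "a \<in> T" "b = a \<or> b = \<tau> a" using no by blast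
    then have "\<tau> (\<tau> a) = a" using assms(2,5) by blast
    then have "orbit \<tau> b = orbit \<tau> a"
      using a(2) assms(2)[OF \<open>b \<in> \<alpha>\<close>] by (auto simp: orbit_involution)
    then show "orbit \<tau> b \<in> orbit \<tau> ` T" using a(1) by blast
  qed
  moreover have "finite (orbit \<tau> ` T)" "card (orbit \<tau> ` T) < n"
    using assms(3,4) card_image_le[of T "orbit \<tau>"] by auto
  ultimately have "finite (orbits_of \<alpha> \<tau>)" "card (orbits_of \<alpha> \<tau>) < n"
    by (auto dest: finite_subset card_mono intro: le_less_trans)
  then show False using assms(1) by (simp add: at_least_elems_def)
qed

section \<open>Infiniteness\<close>

text \<open>The commutator of two reflections of the integers is the translation by 2, so the powers
  of \<open>nw_commutator a b\<close> act by pairwise distinct translations.\<close>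

lemma infinite_cobordism_group:
  assumes "\<And>a. a \<in> \<alpha> \<Longrightarrow> \<tau> a \<in> \<alpha>" "\<And>a. a \<in> \<alpha> \<Longrightarrow> \<tau> (\<tau> a) = a"
    and "a \<in> \<alpha>" "b \<in> \<alpha>" "b \<noteq> a" "b \<noteq> \<tau> a"
  shows "infinite (carrier (cobordism_group \<alpha> \<tau>))"
proof -
  \<comment> \<open>Reflections in 1/2 and in 0. Both are involutions, so it does not matter whether
    \<tau> fixes a letter.\<close>
  define F :: "'a \<Rightarrow> int \<Rightarrow> int" where "F c x = (if c = a \<or> c = \<tau> a then 1 - x else - x)" for c x
  have a_eq: "\<tau> c = a \<longleftrightarrow> c = \<tau> a" "\<tau> c = \<tau> a \<longleftrightarrow> c = a" if "c \<in> \<alpha>" for c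
    using assms(2)[OF that] assms(2)[OF assms(3)] by metis+
  interpret inverse_action \<alpha> \<tau> F
    by unfold_locales (auto simp: F_def assms(1,2) a_eq)
  define w where "w = (\<lambda>n. (nw_mult (nw_commutator a b) ^^ n) nw_empty)"
  have w: "w n \<in> nanowords \<alpha>" for n
    by (induction n)
      (auto simp: w_def nw_empty_closed intro!: nw_mult_closed nw_commutator_closed assms)
  have act: "nw_action (w n) x = x + 2 * int n" for n x
    using assms(5,6) a_eq[OF assms(4)] assms(2)[OF assms(3)]
    by (induction n arbitrary: x)
      (auto simp: w_def nw_action_mult nw_action_commutator F_def)
  have "inj (\<lambda>n. cobordism \<alpha> \<tau> `` {w n})"
  proof (rule injI)
    fix m n assume "cobordism \<alpha> \<tau> `` {w m} = cobordism \<alpha> \<tau> `` {w n}"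
    then have "nw_action (w m) 0 = nw_action (w n) 0"
      using nw_action_class[OF _ w] by metis
    then show "m = n" by (simp add: act)
  qed
  then have "infinite (range (\<lambda>n. cobordism \<alpha> \<tau> `` {w n}))"
    using finite_imageD infinite_UNIV_nat by blast
  moreover have "range (\<lambda>n. cobordism \<alpha> \<tau> `` {w n}) \<subseteq> carrier (cobordism_group \<alpha> \<tau>)"
    using w by (auto simp: cobordism_group_def intro: quotientI)
  ultimately show ?thesis using finite_subset by blast
qed

section \<open>Infinite generation\<close>

text \<open>The lamplighter group acts on pairs of a lamp configuration and a position of the lamplighter;
  \<open>lamp_act D k\<close> switches the lamps in \<open>D\<close>, taken relative to the position, and then moves by \<open>k\<close>.\<close>

definition lamp_act :: "int set \<Rightarrow> int \<Rightarrow> (int \<Rightarrow> bool) \<times> int \<Rightarrow> (int \<Rightarrow> bool) \<times> int" where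
  "lamp_act D k = (\<lambda>(f, n). (\<lambda>m. f m \<noteq> (m - n \<in> D), n + k))"

text \<open>The right factor acts first and moves the lamplighter by \<open>l\<close>, which
  displaces the lamps of \<open>D\<close> by \<open>l\<close>.\<close>

lemma lamp_act_comp: "lamp_act D k \<circ> lamp_act E l = lamp_act (sym_diff E ((\<lambda>m. m + l) ` D)) (k + l)"
proof -
  have "m - (n + l) \<in> D \<longleftrightarrow> m - n \<in> (\<lambda>m. m + l) ` D" for m n
    by (auto simp: image_iff algebra_simps intro: bexI[of _ "m - (n + l)"])
  then show ?thesis by (auto simp: lamp_act_def fun_eq_iff)
qed

lemma lamp_act_id: "id = lamp_act {} 0"
  by (auto simp: lamp_act_def fun_eq_iff)

text \<open>Applied to the dark configuration at position 0, \<open>lamp_act D k\<close> displays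
  \<open>D\<close> and \<open>k\<close>.\<close>

lemma lamp_act_inject: "lamp_act D k = lamp_act E l \<longleftrightarrow> D = E \<and> k = l"
proof
  assume "lamp_act D k = lamp_act E l"
  then have "lamp_act D k (\<lambda>_. False, 0) = lamp_act E l (\<lambda>_. False, 0)" by simp
  then show "D = E \<and> k = l" by (auto simp: lamp_act_def fun_eq_iff)
qed simp

text \<open>Displacements cancel in every nanoword, so it only switches a finite set of lamps. Such
  maps compose by symmetric difference, hence finitely many generators reach only subsets of one
  finite set \<open>E\<close>, whereas repeated conjugation by \<open>a\<close> carries the support
  of a commutator out of every finite set.\<close>

lemma infinitely_generated_cobordism_group:
  assumes "\<And>a. a \<in> \<alpha> \<Longrightarrow> \<tau> a \<in> \<alpha>" "\<And>a. a \<in> \<alpha> \<Longrightarrow> \<tau> (\<tau> a) = a"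
    and "a \<in> \<alpha>" "\<tau> a \<noteq> a" "b \<in> \<alpha>" "b \<noteq> a" "b \<noteq> \<tau> a"
  shows "\<not> finitely_generated_group (cobordism_group \<alpha> \<tau>)"
proof
  let ?G = "cobordism_group \<alpha> \<tau>" and ?c = "\<lambda>u :: (nat, 'a) nanoword. cobordism \<alpha> \<tau> `` {u}"
  interpret G: group ?G by (rule cobordism_group_group)
  \<comment> \<open>The orbit of \<open>a\<close> moves the lamplighter, where
    \<open>\<tau> a \<noteq> a\<close> keeps the displacements 1 and -1 apart; all other letters
    switch the lamp at hand, which is an involution.\<close>
  define e :: "'a \<Rightarrow> int" where "e c = (if c = a then 1 else if c = \<tau> a then -1 else 0)" for c
  define F where "F c = lamp_act (if c = a \<or> c = \<tau> a then {} else {0}) (e c)" for c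
  have a_eq: "\<tau> c = a \<longleftrightarrow> c = \<tau> a" "\<tau> c = \<tau> a \<longleftrightarrow> c = a" if "c \<in> \<alpha>" for c
    using assms(2)[OF that] assms(2)[OF assms(3)] by metis+
  have e_tau: "e (\<tau> c) = - e c" if "c \<in> \<alpha>" for c
    using assms(4) a_eq[OF that] by (auto simp: e_def)
  have F_tau: "F c \<circ> F (\<tau> c) = id" if "c \<in> \<alpha>" for c
    unfolding F_def lamp_act_comp lamp_act_id lamp_act_inject
    using assms(4) a_eq[OF that] by (auto simp: e_def)
  have F_inv: "F c (F (\<tau> c) x) = x" if "c \<in> \<alpha>" for c x
    using fun_cong[OF F_tau[OF that], of x] by (simp only: comp_apply id_apply)
  interpret inverse_action \<alpha> \<tau> F
    by unfold_locales (fact assms(1) assms(2) F_inv)+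

  text \<open>Letters with two occurrences do not contribute to the total displacement.\<close>
  have word: "\<exists>D. finite D \<and>
      word_action p {} w = lamp_act D (- (\<Sum>A | count_list w A = 1. e (p A)))"
    if "\<And>A. A \<in> set w \<Longrightarrow> count_list w A \<le> 2 \<and> p A \<in> \<alpha>" for p and w :: "nat list"
    using that
  proof (induction w)
    case Nil
    show ?case by (intro exI[of _ "{}"]) (simp add: lamp_act_id)
  next
    case (Cons A w)
    have "count_list w B \<le> 2 \<and> p B \<in> \<alpha>" if "B \<in> set w" for B
      using Cons.prems[of B] that by (auto split: if_splits)
    from Cons.IH[OF this] obtain D where D: "finite D"
      "word_action p {} w = lamp_act D (- (\<Sum>A | count_list w A = 1. e (p A)))" by blast
    \<comment> \<open>Finiteness keeps the sum from defaulting to 0.\<close>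
    have "{B. count_list w B = 1} \<subseteq> set w"
      by (rule subsetI, rule ccontr) (simp add: count_list_zero)
    then have fin: "finite {B. count_list w B = 1}"
      by (rule finite_subset) simp
    let ?s = "if A \<in> set w then p A else \<tau> (p A)"
    define X :: "int set" where "X = (if ?s = a \<or> ?s = \<tau> a then {} else {0})"
    \<comment> \<open>A letter new to the suffix is read as a second occurrence and contributes
      \<open>- e (p A)\<close>, whence the minus sign; a letter already met contributes
      \<open>e (p A)\<close> and leaves the index set.\<close>
    have total: "e ?s + - (\<Sum>A | count_list w A = 1. e (p A))
        = - (\<Sum>B | count_list (A # w) B = 1. e (p B))"
    proof (cases "A \<in> set w")
      case True
      then have "count_list w A \<noteq> 0" by (simp add: count_list_0_iff)
      then have A: "count_list w A = 1" using Cons.prems[of A] by simp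
      then have "{B. count_list (A # w) B = 1} = {B. count_list w B = 1} - {A}" by auto
      then show ?thesis using True A fin by (simp add: sum_diff1)
    next
      case False
      then have A: "count_list w A = 0" by (simp add: count_list_0_iff)
      then have "{B. count_list (A # w) B = 1} = insert A {B. count_list w B = 1}" by auto
      then show ?thesis using False A fin Cons.prems[of A] by (simp add: e_tau)
    qed
    define D' where "D' = sym_diff D ((\<lambda>m. m + - (\<Sum>A | count_list w A = 1. e (p A))) ` X)"
    have "finite X" by (simp add: X_def)
    then have "finite D'" using D(1) by (simp add: D'_def)
    moreover have "word_action p {} (A # w) = lamp_act D' (- (\<Sum>B | count_list (A # w) B = 1. e (p B)))"
      by (simp only: word_action_Cons Un_empty_right D(2) F_def X_def D'_def lamp_act_comp total)
    ultimately show ?case by (intro exI[of _ D'] conjI)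
  qed
  \<comment> \<open>No letter occurs exactly once in a nanoword, so the displacement is an empty
    sum.\<close>
  have support: "\<exists>D. finite D \<and> nw_action u = lamp_act D 0" if "u \<in> nanowords \<alpha>"
    for u :: "(nat, 'a) nanoword"
  proof -
    have *: "count_list (snd u) A = 2 \<and> fst u A \<in> \<alpha>" if "A \<in> set (snd u)" for A
      using that \<open>u \<in> nanowords \<alpha>\<close> by (auto simp: nanowords_def)
    have "count_list (snd u) A \<noteq> 1" for A
      using *[of A] count_list_zero[of A "snd u"] by (cases "A \<in> set (snd u)") auto
    moreover have "count_list (snd u) A \<le> 2 \<and> fst u A \<in> \<alpha>" if "A \<in> set (snd u)" for A
      using *[OF that] by simp
    note word[OF this]
    ultimately show ?thesis by (simp add: nw_action_def)
  qed

  assume "finitely_generated_group ?G"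
  then obtain S where S: "finite S" "S \<subseteq> carrier ?G" "generate ?G S = carrier ?G"
    by (auto simp: finitely_generated_group_def)
  have "\<exists>u D. X = ?c u \<and> u \<in> nanowords \<alpha> \<and> finite D \<and> nw_action u = lamp_act D 0"
    if "X \<in> S" for X
  proof -
    have "X \<in> nanowords \<alpha> // cobordism \<alpha> \<tau>"
      using that S(2) by (auto simp: cobordism_group_def)
    then obtain u where "u \<in> nanowords \<alpha>" "X = ?c u" by (rule quotientE)
    then show ?thesis using support[of u] by blast
  qed
  then obtain rep D where rep: "\<And>X. X \<in> S \<Longrightarrow> X = ?c (rep X) \<and> rep X \<in> nanowords \<alpha> \<and>
      finite (D X) \<and> nw_action (rep X) = lamp_act (D X) 0" by metis
  \<comment> \<open>All lamps switched by the chosen representatives of the generators.\<close>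
  define E where "E = (\<Union>X\<in>S. D X)"
  have "finite E" using S(1) rep by (auto simp: E_def)
  have one_class: "\<one>\<^bsub>?G\<^esub> = ?c nw_empty" by (simp add: cobordism_group_def)
  have inverse: "\<exists>u\<in>nanowords \<alpha>. inv\<^bsub>?G\<^esub> (?c v) = ?c u \<and> nw_action v \<circ> nw_action u = id"
    if v: "v \<in> nanowords \<alpha>" for v
  proof -
    have vG: "?c v \<in> carrier ?G" using v by (auto simp: cobordism_group_def intro: quotientI)
    then obtain u where u: "u \<in> nanowords \<alpha>" "inv\<^bsub>?G\<^esub> (?c v) = ?c u"
      using G.inv_closed[OF vG] by (auto simp: cobordism_group_def elim!: quotientE)
    have "?c (nw_mult v u) = ?c nw_empty"
      using G.r_inv[OF vG] unfolding u(2) cobordism_group_mult_class[OF v u(1)] one_class .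
    then have "nw_action (nw_mult v u) = nw_action nw_empty"
      by (rule nw_action_class) (rule nw_empty_closed)
    then show ?thesis using u by (auto simp: nw_action_mult)
  qed
  have gen: "\<exists>u\<in>nanowords \<alpha>. \<exists>D. X = ?c u \<and> D \<subseteq> E \<and> nw_action u = lamp_act D 0"
    if "X \<in> generate ?G S" for X
    using that
  proof induction
    case one
    show ?case
      by (intro bexI[of _ nw_empty] exI[of _ "{}"])
        (simp_all add: one_class lamp_act_id nw_empty_closed)
  next
    case (incl X)
    then show ?case
      using rep[of X] by (intro bexI[of _ "rep X"] exI[of _ "D X"]) (auto simp: E_def)
  next
    case (inv X)
    then have X: "X = ?c (rep X)" "rep X \<in> nanowords \<alpha>" "nw_action (rep X) = lamp_act (D X) 0"
      using rep by blast+
    obtain u where u: "u \<in> nanowords \<alpha>" "inv\<^bsub>?G\<^esub> X = ?c u"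
      "nw_action (rep X) \<circ> nw_action u = id"
      using inverse[OF X(2)] X(1) by metis
    obtain D' where D': "nw_action u = lamp_act D' 0" using support u(1) by blast
    \<comment> \<open>A set of lamps is its own inverse under symmetric difference, so the inverse
      of a generator has the same support.\<close>
    then have "sym_diff D' (D X) = {}"
      using u(3) by (simp add: X(3) lamp_act_comp lamp_act_id lamp_act_inject)
    then have "D' = D X" by blast
    then show ?case using u(1,2) D' inv by (intro bexI[of _ u] exI[of _ "D X"]) (auto simp: E_def)
  next
    case (eng X Y)
    then obtain u D v D' where
      "u \<in> nanowords \<alpha>" "X = ?c u" "D \<subseteq> E" "nw_action u = lamp_act D 0"
      "v \<in> nanowords \<alpha>" "Y = ?c v" "D' \<subseteq> E" "nw_action v = lamp_act D' 0" by blast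
    then show ?case
      by (intro bexI[of _ "nw_mult u v"] exI[of _ "sym_diff D' D"])
        (auto simp: cobordism_group_mult_class nw_action_mult lamp_act_comp intro: nw_mult_closed)
  qed

  \<comment> \<open>Each conjugation by \<open>a\<close> moves the support \<open>{0, -1}\<close> of
    the commutator one step to the left.\<close>
  define w where "w = (\<lambda>k. (nw_conjugate a ^^ k) (nw_commutator a b))"
  have w: "w k \<in> nanowords \<alpha>" for k
    by (induction k) (auto simp: w_def intro!: nw_conjugate_closed nw_commutator_closed assms)
  have F: "F a = lamp_act {} 1" "F (\<tau> a) = lamp_act {} (- 1)"
    "F b = lamp_act {0} 0" "F (\<tau> b) = lamp_act {0} 0"
    using assms(4,6,7) a_eq[OF assms(5)] by (auto simp: F_def e_def)
  have act: "nw_action (w k) = lamp_act {- int k, - int k - 1} 0" for k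
  proof (induction k)
    case 0
    show ?case by (auto simp: w_def nw_action_commutator F lamp_act_comp lamp_act_inject)
  next
    case (Suc k)
    have "nw_action (w (Suc k)) = F a \<circ> nw_action (w k) \<circ> F (\<tau> a)"
      by (simp add: w_def nw_action_conjugate)
    then show ?case by (auto simp: Suc.IH F lamp_act_comp lamp_act_inject)
  qed
  have "- int k \<in> E" for k
  proof -
    have "?c (w k) \<in> generate ?G S"
      using w S(3) by (auto simp: cobordism_group_def intro: quotientI)
    then obtain u D where u: "u \<in> nanowords \<alpha>" "?c (w k) = ?c u" "D \<subseteq> E" "nw_action u = lamp_act D 0"
      using gen by blast
    then have "lamp_act D 0 = lamp_act {- int k, - int k - 1} 0"
      using nw_action_class[OF u(2,1)] act by simp
    then show ?thesis using u(3) by (simp add: lamp_act_inject)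
  qed
  then have "range (\<lambda>k. - int k) \<subseteq> E" by blast
  moreover have "infinite (range (\<lambda>k. - int k))"
    using finite_imageD[of "\<lambda>k. - int k" UNIV] by (auto simp: inj_def)
  ultimately show False using \<open>finite E\<close> finite_subset by blast
qed

section \<open>Non-commutativity\<close>

text \<open>The commutator of the first two transpositions is a 3-cycle on 0, 1, 2, and its
  conjugate by \<open>transpose 2 3\<close> is one on 0, 1, 3. Two 3-cycles whose supports share
  exactly two points do not commute.\<close>

lemma non_abelian_three_orbits:
  assumes "\<And>a. a \<in> \<alpha> \<Longrightarrow> \<tau> a \<in> \<alpha>" "\<And>a. a \<in> \<alpha> \<Longrightarrow> \<tau> (\<tau> a) = a"
    and "a \<in> \<alpha>" "b \<in> \<alpha>" "c \<in> \<alpha>" "b \<noteq> a" "b \<noteq> \<tau> a" "c \<noteq> a" "c \<noteq> \<tau> a" "c \<noteq> b" "c \<noteq> \<tau> b"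
  shows "\<not> comm_group (cobordism_group \<alpha> \<tau>)"
proof -
  \<comment> \<open>All orbits other than those of \<open>a\<close> and \<open>b\<close> share
    \<open>transpose 2 3\<close>, so their number is irrelevant.\<close>
  define F :: "'a \<Rightarrow> nat \<Rightarrow> nat" where "F d = (if d = a \<or> d = \<tau> a then transpose 0 1
    else if d = b \<or> d = \<tau> b then transpose 1 2 else transpose 2 3)" for d
  have eq: "\<tau> d = x \<longleftrightarrow> d = \<tau> x" "\<tau> d = \<tau> x \<longleftrightarrow> d = x" if "d \<in> \<alpha>" "x \<in> \<alpha>" for d x
    using assms(2)[OF that(1)] assms(2)[OF that(2)] by metis+
  interpret inverse_action \<alpha> \<tau> F
    by unfold_locales (auto simp: F_def assms eq)
  have F: "F a = transpose 0 1" "F (\<tau> a) = transpose 0 1" "F b = transpose 1 2"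
    "F (\<tau> b) = transpose 1 2" "F c = transpose 2 3" "F (\<tau> c) = transpose 2 3"
    using assms eq by (auto simp: F_def)
  let ?u = "nw_commutator a b"
  show ?thesis
    by (rule not_comm_groupI[of ?u "nw_conjugate c ?u" 0])
      (auto simp: assms nw_commutator_closed nw_conjugate_closed nw_action_commutator
        nw_action_conjugate F transpose_def)
qed

text \<open>The unit shift conjugates \<open>transpose 0 1\<close> to \<open>transpose 1 2\<close>,
  so the commutator is a 3-cycle on 0, 1, 2. Conjugating it by the shift gives a 3-cycle on 1, 2, 3,
  and again exactly two points are shared.\<close>

lemma non_abelian_free_orbit:
  assumes "\<And>a. a \<in> \<alpha> \<Longrightarrow> \<tau> a \<in> \<alpha>" "\<And>a. a \<in> \<alpha> \<Longrightarrow> \<tau> (\<tau> a) = a"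
    and "a \<in> \<alpha>" "\<tau> a \<noteq> a" "b \<in> \<alpha>" "b \<noteq> a" "b \<noteq> \<tau> a"
  shows "\<not> comm_group (cobordism_group \<alpha> \<tau>)"
proof -
  define F :: "'a \<Rightarrow> int \<Rightarrow> int" where "F d = (if d = a then (\<lambda>n. n + 1)
    else if d = \<tau> a then (\<lambda>n. n - 1) else transpose 0 1)" for d
  have a_eq: "\<tau> c = a \<longleftrightarrow> c = \<tau> a" "\<tau> c = \<tau> a \<longleftrightarrow> c = a" if "c \<in> \<alpha>" for c
    using assms(2)[OF that] assms(2)[OF assms(3)] by metis+
  interpret inverse_action \<alpha> \<tau> F
    by unfold_locales (use assms(4) in \<open>auto simp: F_def assms(1-3) a_eq\<close>)
  have F: "F a = (\<lambda>n. n + 1)" "F (\<tau> a) = (\<lambda>n. n - 1)" "F b = transpose 0 1"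
    "F (\<tau> b) = transpose 0 1"
    using assms a_eq[OF assms(5)] by (auto simp: F_def)
  let ?u = "nw_commutator a b"
  show ?thesis
    by (rule not_comm_groupI[of ?u "nw_conjugate a ?u" 0])
      (auto simp: assms nw_commutator_closed nw_conjugate_closed nw_action_commutator
        nw_action_conjugate F transpose_def)
qed

section \<open>From orbit counts to letters in different orbits\<close>

theorem theorem4p1p2:
  fixes \<alpha> :: "'a set" and \<tau> :: "'a \<Rightarrow> 'a"
  assumes "\<tau> \<in> \<alpha> \<rightarrow> \<alpha>" and "\<And>a. a \<in> \<alpha> \<Longrightarrow> \<tau> (\<tau> a) = a"
  shows "(at_least_elems 2 (orbits_of \<alpha> \<tau>) \<longrightarrow>
           infinite (carrier (cobordism_group \<alpha> \<tau>)))
       \<and> (at_least_elems 2 (orbits_of \<alpha> \<tau>) \<and> (\<exists>a\<in>\<alpha>. \<tau> a \<noteq> a) \<longrightarrow>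
           \<not> finitely_generated_group (cobordism_group \<alpha> \<tau>))
       \<and> (at_least_elems 3 (orbits_of \<alpha> \<tau>) \<or>
           card (orbits_of \<alpha> \<tau>) = 2 \<and> (\<exists>a\<in>\<alpha>. \<tau> a \<noteq> a) \<longrightarrow>
           \<not> comm_group (cobordism_group \<alpha> \<tau>))"
proof -
  have closed: "\<And>a. a \<in> \<alpha> \<Longrightarrow> \<tau> a \<in> \<alpha>" using assms(1) by auto
  note inv = assms(2)
  have new1: "\<exists>b\<in>\<alpha>. b \<noteq> a \<and> b \<noteq> \<tau> a" if "at_least_elems 2 (orbits_of \<alpha> \<tau>)" "a \<in> \<alpha>" for a
    using ex_new_orbit[OF that(1) inv, of "{a}"] that(2) by simp
  \<comment> \<open>The empty \<open>T\<close> turns \<open>ex_new_orbit\<close> into the existence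
    of a letter.\<close>
  have new0: "\<exists>a. a \<in> \<alpha>" if "at_least_elems 2 (orbits_of \<alpha> \<tau>)"
    using ex_new_orbit[OF that inv, of "{}"] by auto
  have inf: "infinite (carrier (cobordism_group \<alpha> \<tau>))" if two: "at_least_elems 2 (orbits_of \<alpha> \<tau>)"
  proof -
    obtain a where a: "a \<in> \<alpha>" using new0[OF two] ..
    obtain b where b: "b \<in> \<alpha>" "b \<noteq> a" "b \<noteq> \<tau> a" using new1[OF two a] by auto
    show ?thesis by (rule infinite_cobordism_group[OF closed inv a b])
  qed
  have free: "\<not> finitely_generated_group (cobordism_group \<alpha> \<tau>) \<and> \<not> comm_group (cobordism_group \<alpha> \<tau>)"
    if two: "at_least_elems 2 (orbits_of \<alpha> \<tau>)" and not_id: "\<exists>a\<in>\<alpha>. \<tau> a \<noteq> a"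
  proof -
    obtain a where a: "a \<in> \<alpha>" "\<tau> a \<noteq> a" using not_id ..
    obtain b where b: "b \<in> \<alpha>" "b \<noteq> a" "b \<noteq> \<tau> a" using new1[OF two a(1)] by auto
    show ?thesis
      using infinitely_generated_cobordism_group[OF closed inv a b]
        non_abelian_free_orbit[OF closed inv a b] by (rule conjI)
  qed
  have three: "\<not> comm_group (cobordism_group \<alpha> \<tau>)" if three: "at_least_elems 3 (orbits_of \<alpha> \<tau>)"
  proof -
    have two: "at_least_elems 2 (orbits_of \<alpha> \<tau>)" using three by (auto simp: at_least_elems_def)
    obtain a where a: "a \<in> \<alpha>" using new0[OF two] ..
    obtain b where b: "b \<in> \<alpha>" "b \<noteq> a" "b \<noteq> \<tau> a" using new1[OF two a] by auto
    have fin: "finite {a, b}" and card: "card {a, b} < 3" and sub: "{a, b} \<subseteq> \<alpha>"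
      using a b(1) by (simp_all add: card_insert_if)
    obtain c where c: "c \<in> \<alpha>" "\<forall>x\<in>{a, b}. c \<noteq> x \<and> c \<noteq> \<tau> x"
      using ex_new_orbit[OF three inv fin card sub] ..
    have c_new: "c \<noteq> a" "c \<noteq> \<tau> a" "c \<noteq> b" "c \<noteq> \<tau> b" using c(2) by simp_all
    show ?thesis
      by (rule non_abelian_three_orbits[OF closed inv a b(1) c(1) b(2,3) c_new])
  qed
  have "at_least_elems 2 (orbits_of \<alpha> \<tau>)" if "card (orbits_of \<alpha> \<tau>) = 2"
    using that by (simp add: at_least_elems_def)
  then show ?thesis using inf free three by meson
qed

end
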